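(* For all integers $k,d\ge 1$, the randomized query complexity of the exact gap group testing (EGGT) problem with parameters $k$ and $d$ is $\widetilde\Omega\big(\min\{k,\;1+(k/d)^2\}\big)$ (regarded as a function of $k$ and $d$, with the universe size $n$ allowed to be chosen; $\widetilde\Omega$ hides polylogarithmic factors in $k$).
   Context: Let $n\ge1$, $[n]=\{1,\dots,n\}$. For $A\subseteq[n]$ define $\mathrm{Intersects}_A:2^{[n]}\to\{0,1\}$ by $\mathrm{Intersects}_A(S)=1$ if $A\cap S\neq\emptyset$ and $0$ otherwise. Let $\mathcal X$ be the family of subsets of $[n]$ of size exactly $k$ and $\mathcal Y$ the family of subsets of size exactly $k+d$. In the EGGT problem with parameters $k,d$, one is given oracle access to $\mathrm{Intersects}_A$ for some $A\in\mathcal X\cup\mathcal Y$ (a query on $S$ returns $\mathrm{Intersects}_A(S)$) and must decide whether $A\in\mathcal X$ or $A\in\mathcal Y$. The randomized query complexity is the minimum, over randomized algorithms correct with probability at least $2/3$ on every allowed input, of the worst-case number of queries. *)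

theory Defs
  imports "HOL-Probability.Probability_Mass_Function"
begin

text \<open>
  A deterministic query algorithm: \<open>Query S t0 t1\<close> asks the oracle about \<open>S\<close> and continues
  with \<open>t0\<close> on the answer 0 (False) and with \<open>t1\<close> on the answer 1 (True).
\<close>

datatype (queries: 'q) decision_tree =
  Answer bool
| Query 'q "'q decision_tree" "'q decision_tree"

primrec run :: "'q decision_tree \<Rightarrow> ('q \<Rightarrow> bool) \<Rightarrow> bool" where
  "run (Answer b) f = b"
| "run (Query q t0 t1) f = (if f q then run t1 f else run t0 f)"

primrec num_queries :: "'q decision_tree \<Rightarrow> ('q \<Rightarrow> bool) \<Rightarrow> nat" where
  "num_queries (Answer b) f = 0"
| "num_queries (Query q t0 t1) f = Suc (if f q then num_queries t1 f else num_queries t0 f)"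

definition intersects :: "'a set \<Rightarrow> 'a set \<Rightarrow> bool" where
  "intersects A S \<longleftrightarrow> A \<inter> S \<noteq> {}"

definition sized_subsets :: "nat \<Rightarrow> nat \<Rightarrow> nat set set" where
  "sized_subsets n m = {A. A \<subseteq> {1..n} \<and> card A = m}"

text \<open>
  A randomized query algorithm is a probability distribution over deterministic ones. Since the
  universe is finite there are only countably many decision trees, so discrete distributions are
  fully general. The output True stands for the verdict \<open>card A = k + d\<close>.
\<close>

definition solves_eggt :: "nat \<Rightarrow> nat \<Rightarrow> nat \<Rightarrow> nat set decision_tree pmf \<Rightarrow> bool" where
  "solves_eggt n k d p \<longleftrightarrow>
     (\<forall>t\<in>set_pmf p. queries t \<subseteq> Pow {1..n}) \<and>
     (\<forall>A\<in>sized_subsets n k. measure_pmf.prob p {t. \<not> run t (intersects A)} \<ge> 2/3) \<and>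
     (\<forall>A\<in>sized_subsets n (k + d). measure_pmf.prob p {t. run t (intersects A)} \<ge> 2/3)"

definition eggt_queries_at_most ::
    "nat \<Rightarrow> nat \<Rightarrow> nat \<Rightarrow> nat set decision_tree pmf \<Rightarrow> nat \<Rightarrow> bool" where
  "eggt_queries_at_most n k d p q \<longleftrightarrow>
     (\<forall>t\<in>set_pmf p. \<forall>A\<in>sized_subsets n k \<union> sized_subsets n (k + d).
        num_queries t (intersects A) \<le> q)"

definition eggt_query_complexity :: "nat \<Rightarrow> nat \<Rightarrow> nat \<Rightarrow> nat" where
  "eggt_query_complexity n k d =
     (LEAST q. \<exists>p. solves_eggt n k d p \<and> eggt_queries_at_most n k d p q)"

text \<open>
  For \<open>d \<ge> 1\<close> the minimum is attained: querying all singletons reveals the hidden set.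
\<close>

lemma ex_learning_tree:
  "\<exists>t. queries t \<subseteq> (\<lambda>x. {x}) ` set xs \<and>
       (\<forall>A. run t (intersects A) = g (A \<inter> set xs) \<and> num_queries t (intersects A) \<le> length xs)"
proof (induction xs arbitrary: g)
  case Nil
  show ?case by (rule exI[of _ "Answer (g {})"]) simp
next
  case (Cons x xs)
  obtain t0 where t0: "queries t0 \<subseteq> (\<lambda>x. {x}) ` set xs"
    "\<And>A. run t0 (intersects A) = g (A \<inter> set xs)"
    "\<And>A. num_queries t0 (intersects A) \<le> length xs"
    using Cons.IH[of g] by blast
  obtain t1 where t1: "queries t1 \<subseteq> (\<lambda>x. {x}) ` set xs"
    "\<And>A. run t1 (intersects A) = g (insert x (A \<inter> set xs))"
    "\<And>A. num_queries t1 (intersects A) \<le> length xs"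
    using Cons.IH[of "\<lambda>B. g (insert x B)"] by blast
  have "intersects A {x} \<longleftrightarrow> x \<in> A" for A
    by (simp add: intersects_def)
  then show ?case
    by (intro exI[of _ "Query {x} t0 t1"]) (use t0 t1 in auto)
qed

lemma eggt_query_complexity_attained:
  assumes "d \<ge> 1"
  shows "\<exists>p. solves_eggt n k d p \<and> eggt_queries_at_most n k d p (eggt_query_complexity n k d)"
proof -
  have set: "set [1..<Suc n] = {1..n}" and len: "length [1..<Suc n] = n"
    by (simp_all add: atLeastLessThanSuc_atLeastAtMost del: upt_Suc)
  obtain t where t: "queries t \<subseteq> (\<lambda>x. {x}) ` {1..n}"
    "\<And>A. run t (intersects A) \<longleftrightarrow> card (A \<inter> {1..n}) = k + d"
    "\<And>A. num_queries t (intersects A) \<le> n"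
    using ex_learning_tree[of "[1..<Suc n]" "\<lambda>B. card B = k + d"]
    unfolding set len by blast
  have "queries t \<subseteq> Pow {1..n}"
    using t(1) by auto
  moreover have "run t (intersects A) \<longleftrightarrow> m = k + d" if "A \<in> sized_subsets n m" for A m
    using t(2)[of A] that by (simp add: sized_subsets_def Int_absorb2)
  ultimately have "solves_eggt n k d (return_pmf t)"
    using assms by (simp add: solves_eggt_def measure_return_pmf)
  moreover have "eggt_queries_at_most n k d (return_pmf t) n"
    using t(3) by (simp add: eggt_queries_at_most_def)
  ultimately have "\<exists>q p. solves_eggt n k d p \<and> eggt_queries_at_most n k d p q"
    by blast
  then show ?thesis
    unfolding eggt_query_complexity_def by (rule LeastI_ex)
qed

end

theory Submission
  imports Defs
begin

text \<open>
  Let the hidden set be uniform of size \<open>k\<close> or \<open>k + d\<close>, and strengthen the oracle: a query \<open>S\<close> scans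
  the elements of \<open>S\<close> of unknown status one by one, reveals their status, and stops at the first
  element of the hidden set. Then the hidden set stays uniform on the unscanned elements, and each
  query reveals at most one of its elements.

  Write \<open>\<alpha>\<close>, \<open>\<beta>\<close> for the acceptance probabilities of a \<open>q\<close>-query algorithm for \<open>j\<close> and \<open>j + d\<close> hidden
  elements among \<open>u\<close> unscanned ones. By the Cauchy-Schwarz inequality, applied to each scanned
  element, \<open>\<beta> \<le> sqrt (M ^ q * \<alpha>) + 2 * (j + d) / u\<close>, where \<open>M\<close> bounds the second moment of the
  likelihood ratio of one query. While \<open>u\<close> is large one can take \<open>M = 1 + O((d / j)^2)\<close>; the
  additive term is a martingale along the scan and makes the bound trivial once \<open>u\<close> is small.
  Correctness forces \<open>\<alpha> \<le> 1/3\<close> and \<open>\<beta> \<ge> 2/3\<close>, so \<open>M ^ q\<close> exceeds 1 by a constant, and hence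
  \<open>q\<close> is at least of order \<open>(k / d)^2\<close> unless \<open>q > k / 2\<close>.
\<close>

section \<open>Averages over the subsets of a fixed size\<close>

definition subset_avg :: "('a set \<Rightarrow> bool) \<Rightarrow> 'a set \<Rightarrow> nat \<Rightarrow> real" where
  "subset_avg X U j = (\<Sum>B | B \<subseteq> U \<and> card B = j. of_bool (X B)) / real (card U choose j)"

lemma subset_avg_cong:
  assumes "\<And>B. B \<subseteq> U \<Longrightarrow> card B = j \<Longrightarrow> X B = Y B"
  shows "subset_avg X U j = subset_avg Y U j"
  unfolding subset_avg_def using assms by (auto intro!: arg_cong2[where f = "(/)"] sum.cong)

lemma subset_avg_nonneg: "0 \<le> subset_avg X U j"
  unfolding subset_avg_def by (intro divide_nonneg_nonneg sum_nonneg) auto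

lemma subset_avg_const:
  assumes "finite U" "j \<le> card U"
  shows "subset_avg (\<lambda>_. b) U j = of_bool b"
  using assms by (simp add: subset_avg_def n_subsets)

lemma subset_avg_le_1:
  assumes "finite U"
  shows "subset_avg X U j \<le> 1"
proof -
  have "(\<Sum>B | B \<subseteq> U \<and> card B = j. of_bool (X B)) \<le> (\<Sum>B | B \<subseteq> U \<and> card B = j. 1 :: real)"
    by (intro sum_mono) auto
  also have "\<dots> = real (card U choose j)"
    using assms by (simp add: n_subsets)
  finally show ?thesis
    by (cases "card U choose j = 0") (simp_all add: subset_avg_def del: binomial_eq_0_iff)
qed

text \<open>Conditioning on whether the random set contains \<open>x\<close>: what remains of it is
  uniform on \<open>U - {x}\<close>, of size \<open>j - 1\<close> after a hit and \<open>j\<close>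
  after a miss. The absorption identities for binomials give the weights.\<close>

lemma subset_avg_split:
  assumes "finite U" "x \<in> U" "0 < j" "j < card U"
  shows "subset_avg X U j = real j / real (card U) * subset_avg (\<lambda>B. X (insert x B)) (U - {x}) (j - 1)
    + (1 - real j / real (card U)) * subset_avg X (U - {x}) j"
proof -
  define u where "u = card U"
  have u: "card (U - {x}) = u - 1" "j < u"
    using assms by (simp_all add: u_def)
  let ?F = "\<lambda>i. {B. B \<subseteq> U - {x} \<and> card B = i}"
  have fin: "finite (?F i)" for i
    using assms(1) by simp
  have fB: "finite B" if "B \<subseteq> U" for B
    using that assms(1) finite_subset by blast
  have "{B. B \<subseteq> U \<and> card B = j} = insert x ` ?F (j - 1) \<union> ?F j"
  proof (intro equalityI subsetI)
    fix B assume B: "B \<in> {B. B \<subseteq> U \<and> card B = j}"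
    show "B \<in> insert x ` ?F (j - 1) \<union> ?F j"
    proof (cases "x \<in> B")
      case True
      then have "B = insert x (B - {x})" "B - {x} \<in> ?F (j - 1)"
        using B fB by auto
      then show ?thesis by blast
    qed (use B in auto)
  next
    fix B assume "B \<in> insert x ` ?F (j - 1) \<union> ?F j"
    then show "B \<in> {B. B \<subseteq> U \<and> card B = j}"
    proof
      assume "B \<in> insert x ` ?F (j - 1)"
      then obtain B' where B': "B = insert x B'" "B' \<subseteq> U - {x}" "card B' = j - 1"
        by auto
      then have "x \<notin> B'" "finite B'"
        using fB by auto
      then show ?thesis
        using B' assms by auto
    qed auto
  qed
  moreover have "insert x ` ?F (j - 1) \<inter> ?F j = {}"
    by auto
  moreover have "inj_on (insert x) (?F (j - 1))"
    by (auto simp: inj_on_def insert_ident subset_iff)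
  ultimately have sum: "(\<Sum>B | B \<subseteq> U \<and> card B = j. of_bool (X B) :: real) =
      (\<Sum>B\<in>?F (j - 1). of_bool (X (insert x B))) + (\<Sum>B\<in>?F j. of_bool (X B))"
    using fin by (simp add: sum.union_disjoint sum.reindex del: sum_of_bool_eq)
  have "j * (u choose j) = u * (u - 1 choose (j - 1))"
    using times_binomial_minus1_eq assms(3) by blast
  then have c1: "real j * real (u choose j) = real u * real (u - 1 choose (j - 1))"
    by (metis of_nat_mult)
  have "(u - j) * (u choose j) = u * (u - 1 choose j)"
    by (rule binomial_absorb_comp)
  then have c2: "(real u - real j) * real (u choose j) = real u * real (u - 1 choose j)"
    using u(2) by (metis less_imp_le of_nat_diff of_nat_mult)
  have "u > 0" "u choose j > 0" "u - 1 choose (j - 1) > 0" "u - 1 choose j > 0"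
    using u(2) by auto
  then have "real j / real u * (a / real (u - 1 choose (j - 1))) = a / real (u choose j)"
    and "(1 - real j / real u) * (a / real (u - 1 choose j)) = a / real (u choose j)" for a
    using c1 c2 by (simp_all add: field_simps)
  then show ?thesis
    unfolding subset_avg_def sum u(1) by (simp add: add_divide_distrib flip: u_def)
qed

section \<open>Change of measure for one scanned element\<close>

text \<open>Here \<open>p\<close> and \<open>r\<close> are the probabilities of a hit with
  \<open>j\<close> and \<open>j + d\<close> hidden elements. Only the miss term carries
  \<open>M\<close>, because a hit ends the query while a miss continues it; so \<open>M\<close>
  bounds the second moment of a whole query, however many elements it scans.\<close>

lemma likelihood_ratio_second_moment:
  fixes j d u M :: real
  assumes "0 < j" "0 \<le> d" "2 * (j + d) < u" "1 + 2 * (d / j)\<^sup>2 \<le> M"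
  defines "p \<equiv> j / u" and "r \<equiv> (j + d) / u"
  shows "r\<^sup>2 / p + M * ((1 - r)\<^sup>2 / (1 - p)) \<le> M"
proof -
  have u: "u > 0" and uj: "u - j > 0" using assms(1-3) by simp_all
  have M: "M * j\<^sup>2 \<ge> j\<^sup>2 + 2 * d\<^sup>2"
    using assms(1,4) by (simp add: field_simps)
  \<comment> \<open>\<open>w\<close> is the numerator of
    \<open>1 - (1 - r)\<^sup>2 / (1 - p)\<close> over \<open>u * (u - j)\<close>. Having more than
    \<open>2 * (j + d)\<close> elements left gives \<open>j * u \<le> 2 * w\<close>, which is the
    source of the 2 in \<open>1 + 2 * (d / j)\<^sup>2\<close>.\<close>
  define w where "w = (j + 2 * d) * u - (j + d)\<^sup>2"
  have "(j + d) * (2 * (j + d)) \<le> (j + d) * u"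
    using assms by (intro mult_left_mono) auto
  moreover have "0 \<le> d * u"
    using u assms(2) by simp
  ultimately have w: "2 * w \<ge> j * u"
    by (simp add: w_def power2_eq_square algebra_simps)
  then have w0: "w \<ge> 0"
    using u assms(1) by (smt (verit) mult_pos_pos)
  have "(j + d)\<^sup>2 * (u - j) * j \<le> M * j\<^sup>2 * w"
  proof -
    have "(j + d)\<^sup>2 * (u - j) * j = j\<^sup>2 * w + d\<^sup>2 * (j * u)"
      by (simp add: w_def power2_eq_square algebra_simps)
    also have "\<dots> \<le> j\<^sup>2 * w + d\<^sup>2 * (2 * w)"
      using w by (intro add_left_mono mult_left_mono) auto
    also have "\<dots> = (j\<^sup>2 + 2 * d\<^sup>2) * w"
      by (simp add: algebra_simps)
    also have "\<dots> \<le> M * j\<^sup>2 * w"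
      using M w0 by (rule mult_right_mono)
    finally show ?thesis .
  qed
  then have "j * ((j + d)\<^sup>2 * (u - j)) \<le> j * (M * j * w)"
    by (simp add: power2_eq_square algebra_simps)
  then have key: "(j + d)\<^sup>2 * (u - j) \<le> M * j * w"
    using assms(1) by simp
  have "r\<^sup>2 / p = (j + d)\<^sup>2 / (u * j)"
    using u assms(1) by (simp add: p_def r_def field_simps power2_eq_square)
  moreover have "1 - (1 - r)\<^sup>2 / (1 - p) = w / (u * (u - j))"
  proof -
    have "1 - p = (u - j) / u" "1 - r = (u - j - d) / u"
      using u by (simp_all add: p_def r_def field_simps)
    then have "(1 - r)\<^sup>2 / (1 - p) = (u - j - d)\<^sup>2 / (u * (u - j))"
      using u uj by (simp add: field_simps power2_eq_square)
    moreover have "(u - j - d)\<^sup>2 = u * (u - j) - w"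
      by (simp add: w_def power2_eq_square algebra_simps)
    ultimately show ?thesis
      using u uj by (simp add: diff_divide_distrib)
  qed
  moreover have "(j + d)\<^sup>2 / (u * j) \<le> M * (w / (u * (u - j)))"
  proof -
    have "(j + d)\<^sup>2 / j \<le> M * w / (u - j)"
      using key uj assms(1) by (simp add: field_simps)
    then have "(j + d)\<^sup>2 / j / u \<le> M * w / (u - j) / u"
      using u by (intro divide_right_mono) auto
    then show ?thesis
      by (simp add: mult.commute)
  qed
  ultimately have "r\<^sup>2 / p \<le> M * (1 - (1 - r)\<^sup>2 / (1 - p))"
    by simp
  then show ?thesis
    by (simp add: algebra_simps)
qed

text \<open>Cauchy-Schwarz on a two-point space: \<open>a1\<close> and \<open>a2\<close> are
  acceptance probabilities after a hit and a miss, \<open>m\<close> the moment factor of the later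
  queries. By \<open>moment\<close>, the factor \<open>M * m\<close> of the miss branch also
  suffices before the scan.\<close>

lemma mixture_sqrt_bound:
  fixes p r M m a1 a2 :: real
  assumes p: "0 < p" "p < 1"
    and nonneg: "0 \<le> M" "0 \<le> m" "0 \<le> a1" "0 \<le> a2"
    and moment: "r\<^sup>2 / p + M * ((1 - r)\<^sup>2 / (1 - p)) \<le> M"
  shows "r * sqrt (m * a1) + (1 - r) * sqrt (M * m * a2) \<le> sqrt (M * m * (p * a1 + (1 - p) * a2))"
proof -
  define x1 x2 y1 y2 where "x1 = r / sqrt p" and "x2 = (1 - r) * sqrt M / sqrt (1 - p)"
    and "y1 = sqrt (p * a1)" and "y2 = sqrt ((1 - p) * a2)"
  have "(x1 * y1 + x2 * y2)\<^sup>2 \<le> (x1\<^sup>2 + x2\<^sup>2) * (y1\<^sup>2 + y2\<^sup>2)"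
    using zero_le_power2[of "x1 * y2 - x2 * y1"] by (simp add: power2_eq_square algebra_simps)
  also have "x1\<^sup>2 + x2\<^sup>2 = r\<^sup>2 / p + M * ((1 - r)\<^sup>2 / (1 - p))"
    using p nonneg by (simp add: x1_def x2_def power_divide power_mult_distrib mult.commute)
  also have "y1\<^sup>2 + y2\<^sup>2 = p * a1 + (1 - p) * a2"
    using p nonneg by (simp add: y1_def y2_def)
  also have "(r\<^sup>2 / p + M * ((1 - r)\<^sup>2 / (1 - p))) * (p * a1 + (1 - p) * a2)
      \<le> M * (p * a1 + (1 - p) * a2)"
    using moment p nonneg by (intro mult_right_mono) auto
  finally have "x1 * y1 + x2 * y2 \<le> sqrt (M * (p * a1 + (1 - p) * a2))"
    by (rule real_le_rsqrt)
  then have "sqrt m * (x1 * y1 + x2 * y2) \<le> sqrt m * sqrt (M * (p * a1 + (1 - p) * a2))"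
    using nonneg by (intro mult_left_mono) auto
  moreover have "x1 * y1 = r * sqrt a1" "x2 * y2 = (1 - r) * sqrt (M * a2)"
    using p by (simp_all add: x1_def x2_def y1_def y2_def real_sqrt_mult)
  moreover have "sqrt m * sqrt (M * (p * a1 + (1 - p) * a2)) = sqrt (M * m * (p * a1 + (1 - p) * a2))"
    by (simp only: real_sqrt_mult mult_ac)
  ultimately show ?thesis
    by (simp add: real_sqrt_mult distrib_left mult_ac)
qed

section \<open>The bound for deterministic trees\<close>

text \<open>Truncation turns the query budget into an induction parameter valid for every tree and
  oracle, whereas \<open>eggt_queries_at_most\<close> restricts only inputs of the allowed sizes.
  The verdict \<open>False\<close> on an exhausted budget is arbitrary.\<close>

primrec run_upto :: "nat \<Rightarrow> 'q decision_tree \<Rightarrow> ('q \<Rightarrow> bool) \<Rightarrow> bool" where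
  "run_upto 0 t f = (case t of Answer b \<Rightarrow> b | Query _ _ _ \<Rightarrow> False)"
| "run_upto (Suc q) t f =
    (case t of Answer b \<Rightarrow> b | Query s t0 t1 \<Rightarrow> run_upto q (if f s then t1 else t0) f)"

lemma run_upto_eq_run: "num_queries t f \<le> q \<Longrightarrow> run_upto q t f = run t f"
  by (induction q arbitrary: t) (auto split: decision_tree.splits if_splits)

lemma subset_avg_bound_const:
  assumes "finite U" "j + d \<le> card U" "1 \<le> M" "0 \<le> e"
  shows "subset_avg (\<lambda>_. b) U (j + d) \<le> sqrt (M * subset_avg (\<lambda>_. b) U j) + e"
  using assms by (cases b) (simp_all add: subset_avg_const add_increasing2)

text \<open>\<open>K\<close> holds the revealed hidden elements and \<open>U\<close> the unscanned
  ones. As each query reveals at most one hidden element, \<open>j0 + q \<le> j\<close> keeps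
  \<open>j\<close> at least \<open>j0\<close> throughout, so a single \<open>M\<close> serves all
  queries.\<close>

lemma subset_avg_run_upto_bound:
  fixes M :: real
  assumes "0 < j0" and M: "1 + 2 * (real d / real j0)\<^sup>2 \<le> M"
    and "finite U" and "j0 + q \<le> j"
  shows "subset_avg (\<lambda>B. run_upto q t (intersects (K \<union> B))) U (j + d)
    \<le> sqrt (M ^ q * subset_avg (\<lambda>B. run_upto q t (intersects (K \<union> B))) U j)
      + 2 * real (j + d) / real (card U)"
  using assms(3,4)
proof (induction q arbitrary: t K U j)
  have M1: "1 \<le> M"
    using M zero_le_power2[of "real d / real j0"] by linarith
  have small: "subset_avg X U (j + d)
      \<le> sqrt (M ^ q * subset_avg X U j) + 2 * real (j + d) / real (card U)"
    if "finite U" "card U \<le> 2 * (j + d)" "0 < j" for X :: "'a set \<Rightarrow> bool" and U j q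
  proof (cases "card U = 0")
    \<comment> \<open>For empty \<open>U\<close> the additive term is 0 by division by zero, but no
      subset of size \<open>j + d > 0\<close> exists, so the left side vanishes too.\<close>
    case True
    then have "subset_avg X U (j + d) = 0"
      using that by (simp add: subset_avg_def binomial_eq_0)
    moreover have "0 \<le> sqrt (M ^ q * subset_avg X U j)"
      using M1 by (simp add: subset_avg_nonneg)
    ultimately show ?thesis
      by simp
  next
    case False
    have "real (card U) \<le> 2 * real (j + d)"
      using that(2) by linarith
    then have "1 \<le> 2 * real (j + d) / real (card U)"
      using False by (simp add: le_divide_eq)
    moreover have "0 \<le> sqrt (M ^ q * subset_avg X U j)"
      using M1 by (simp add: subset_avg_nonneg)
    ultimately show ?thesis
      using subset_avg_le_1[OF that(1), of X "j + d"] by linarith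
  qed
  {
    case 0
    then show ?case
      using small[of U j _ 0] subset_avg_bound_const[of U j d 1] \<open>0 < j0\<close>
      by (cases "card U \<le> 2 * (j + d)") (auto split: decision_tree.splits)
  next
    case (Suc q)
    have Mq: "1 \<le> M ^ q" for q
      using M1 by simp
    have mono: "sqrt (M ^ q * a) \<le> sqrt (M ^ Suc q * a)" if "0 \<le> a" for a
      using that M1 Mq[of q] by (intro real_sqrt_le_mono mult_right_mono) auto
    show ?case
    proof (cases t)
      case (Answer b)
      then show ?thesis
        using small[of U j _ "Suc q"] subset_avg_bound_const[of U j d "M ^ Suc q"] Suc.prems \<open>0 < j0\<close>
          Mq[of "Suc q"]
        by (cases "card U \<le> 2 * (j + d)") (auto simp del: power_Suc)
    next
      case (Query S t0 t1)
      let ?X = "\<lambda>B. run_upto (Suc q) t (intersects (K \<union> B))"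
      show ?thesis
      \<comment> \<open>If \<open>S\<close> meets \<open>K\<close>, the answer 1 is already known
        and nothing is scanned.\<close>
      proof (cases "K \<inter> S = {}")
        case False
        then have eq: "?X = (\<lambda>B. run_upto q t1 (intersects (K \<union> B)))"
          using Query by (auto simp: intersects_def fun_eq_iff)
        show ?thesis
          unfolding eq
          by (rule order_trans[OF Suc.IH add_right_mono[OF mono[OF subset_avg_nonneg]]])
            (use Suc.prems in auto)
      next
        case True
        show ?thesis
          using Suc.prems
        \<comment> \<open>The inner induction scans \<open>S\<close>. A miss shrinks
          \<open>U\<close> but keeps \<open>K\<close>, \<open>j\<close> and the budget; a hit ends
          the query and passes to the outer induction hypothesis.\<close>
        proof (induction "card (U \<inter> S)" arbitrary: U rule: less_induct)
          case less
          show ?case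
          proof (cases "U \<inter> S = {}")
            case disj: True
            have eq: "subset_avg ?X U i = subset_avg (\<lambda>B. run_upto q t0 (intersects (K \<union> B))) U i" for i
            proof (rule subset_avg_cong)
              fix B assume "B \<subseteq> U"
              then have "\<not> intersects (K \<union> B) S"
                using disj True by (auto simp: intersects_def)
              then show "?X B = run_upto q t0 (intersects (K \<union> B))"
                using Query by simp
            qed
            show ?thesis
              unfolding eq
              by (rule order_trans[OF Suc.IH add_right_mono[OF mono[OF subset_avg_nonneg]]])
                (use less.prems in auto)
          next
            case False
            then obtain x where x: "x \<in> U" "x \<in> S" by blast
            show ?thesis
            proof (cases "card U \<le> 2 * (j + d)")
              case True
              then show ?thesis
                by (intro small) (use less.prems \<open>0 < j0\<close> in auto)
            next
              case big: False
              define u where "u = card U"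
              let ?U = "U - {x}" and ?Y = "\<lambda>B. ?X (insert x B)"
              have u: "2 * (j + d) < u" "card ?U = u - 1"
                using big x less.prems by (simp_all add: u_def)
              have j: "0 < j" "j0 \<le> j" "j0 + q \<le> j - 1"
                using less.prems \<open>0 < j0\<close> by auto
              have hit_eq: "?Y = (\<lambda>B. run_upto q t1 (intersects (insert x K \<union> B)))"
                using x Query by (auto simp: intersects_def fun_eq_iff)
              have jd: "j - 1 + d = j + d - 1"
                using j by simp
              have hit: "subset_avg ?Y ?U (j + d - 1)
                  \<le> sqrt (M ^ q * subset_avg ?Y ?U (j - 1)) + 2 * (real (j + d) - 1) / (real u - 1)"
                using Suc.IH[of ?U "j - 1" t1 "insert x K"] less.prems j u
                unfolding hit_eq jd by (simp add: of_nat_diff)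
              have "card (?U \<inter> S) < card (U \<inter> S)"
                using x less.prems by (intro psubset_card_mono) auto
              then have miss: "subset_avg ?X ?U (j + d)
                  \<le> sqrt (M * M ^ q * subset_avg ?X ?U j) + 2 * real (j + d) / (real u - 1)"
                using less.hyps[of ?U] less.prems u by (simp add: of_nat_diff)
              let ?p = "real j / real u" and ?r = "real (j + d) / real u"
              have r: "0 \<le> ?r" "?r \<le> 1" and p: "0 < ?p" "?p < 1"
                using u j by auto
              have "real d / real j \<le> real d / real j0"
                using j \<open>0 < j0\<close> by (intro divide_left_mono) auto
              then have "(real d / real j)\<^sup>2 \<le> (real d / real j0)\<^sup>2"
                by (intro power_mono) auto
              then have "1 + 2 * (real d / real j)\<^sup>2 \<le> M"
                using M by linarith
              then have moment: "?r\<^sup>2 / ?p + M * ((1 - ?r)\<^sup>2 / (1 - ?p)) \<le> M"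
                using likelihood_ratio_second_moment[of "real j" "real d" "real u" M] j u by simp
              \<comment> \<open>With \<open>j + d\<close> hidden elements, their proportion among
                the unscanned ones is a martingale, so the additive terms recombine exactly and no
                error accumulates over the scan.\<close>
              have martingale: "?r * (2 * (real (j + d) - 1) / (real u - 1))
                  + (1 - ?r) * (2 * real (j + d) / (real u - 1)) = 2 * real (j + d) / real u"
              proof -
                have "?r * (2 * (real (j + d) - 1) / (real u - 1))
                    + (1 - ?r) * (2 * real (j + d) / (real u - 1))
                  = (?r * (2 * (real (j + d) - 1)) + (1 - ?r) * (2 * real (j + d))) / (real u - 1)"
                  by (simp only: add_divide_distrib times_divide_eq_right)
                also have "?r * (2 * (real (j + d) - 1)) + (1 - ?r) * (2 * real (j + d))
                  = 2 * ?r * (real u - 1)"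
                  using u by (simp add: field_simps)
                finally show ?thesis
                  using u j by simp
              qed
              have "subset_avg ?X U (j + d)
                  = ?r * subset_avg ?Y ?U (j + d - 1) + (1 - ?r) * subset_avg ?X ?U (j + d)"
                using subset_avg_split[of U x "j + d" ?X] less.prems x j u by (simp add: u_def)
              also have "\<dots> \<le> ?r * (sqrt (M ^ q * subset_avg ?Y ?U (j - 1))
                    + 2 * (real (j + d) - 1) / (real u - 1))
                  + (1 - ?r) * (sqrt (M * M ^ q * subset_avg ?X ?U j)
                    + 2 * real (j + d) / (real u - 1))"
                using hit miss r by (intro add_mono mult_left_mono) auto
              also have "\<dots> = ?r * sqrt (M ^ q * subset_avg ?Y ?U (j - 1))
                  + (1 - ?r) * sqrt (M * M ^ q * subset_avg ?X ?U j) + 2 * real (j + d) / real u"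
                using martingale by (simp add: distrib_left del: run_upto.simps)
              also have "\<dots> \<le> sqrt (M * M ^ q
                  * (?p * subset_avg ?Y ?U (j - 1) + (1 - ?p) * subset_avg ?X ?U j))
                  + 2 * real (j + d) / real u"
                using M1 p moment by (intro add_right_mono mixture_sqrt_bound subset_avg_nonneg) auto
              also have "?p * subset_avg ?Y ?U (j - 1) + (1 - ?p) * subset_avg ?X ?U j
                  = subset_avg ?X U j"
                using subset_avg_split[of U x j ?X] less.prems x j u by (simp add: u_def)
              finally show ?thesis
                by (simp add: u_def)
            qed
          qed
        qed
      qed
    qed
  }
qed

section \<open>From deterministic trees to randomized algorithms\<close>

text \<open>Averaging over hidden sets is a finite sum, so it commutes with the expectation over
  trees. This carries correctness on every input over to the uniform input, as in the easy direction
  of Yao's principle.\<close>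

lemma expectation_subset_avg:
  fixes p :: "'t pmf"
  shows "integrable p (\<lambda>t. subset_avg (X t) U j)"
    and "measure_pmf.expectation p (\<lambda>t. subset_avg (X t) U j)
      = (\<Sum>B | B \<subseteq> U \<and> card B = j. measure_pmf.prob p {t. X t B}) / real (card U choose j)"
proof -
  have ind: "(of_bool (X t B) :: real) = indicator {t. X t B} t" for t B
    by (simp add: indicator_def)
  have int: "integrable p (indicator {t. X t B} :: 't \<Rightarrow> real)" for B
    by (rule measure_pmf.integrable_const_bound[where B = 1]) auto
  then show "integrable p (\<lambda>t. subset_avg (X t) U j)"
    unfolding subset_avg_def ind by (intro integrable_divide Bochner_Integration.integrable_sum)
  show "measure_pmf.expectation p (\<lambda>t. subset_avg (X t) U j)
      = (\<Sum>B | B \<subseteq> U \<and> card B = j. measure_pmf.prob p {t. X t B}) / real (card U choose j)"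
    unfolding subset_avg_def ind
    by (subst integral_divide_zero, subst Bochner_Integration.integral_sum) (simp_all add: int)
qed

text \<open>Averaging the tree bound, with its square root linearised, gives
  \<open>2 / 3 \<le> M ^ q / 4 + 1 / 3 + 1 / 100\<close>, hence
  \<open>M ^ q \<ge> 97 / 75 > 5 / 4\<close>.\<close>

lemma solves_eggt_moment_bound:
  fixes M :: real
  assumes solves: "solves_eggt n k d p" and queries: "eggt_queries_at_most n k d p q"
    and "q < k" and n: "200 * (k + d) \<le> n"
    and M: "1 + 2 * (real d / real (k - q))\<^sup>2 \<le> M"
  shows "M ^ q \<ge> 5 / 4"
proof -
  let ?U = "{1..n}"
  let ?f = "\<lambda>i t. subset_avg (\<lambda>B. run t (intersects B)) ?U i"
  have n0: "0 < n" "k \<le> n" "k + d \<le> n"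
    using n \<open>q < k\<close> by auto
  have "0 \<le> M"
    using M zero_le_power2[of "real d / real (k - q)"] by linarith
  then have Mq: "0 \<le> M ^ q" by simp
  have "?f (k + d) t \<le> 3 / 4 * (M ^ q * ?f k t) + 1 / 3 + 1 / 100" if t: "t \<in> set_pmf p" for t
  proof -
    \<comment> \<open>On inputs of the two allowed sizes the truncation has no effect.\<close>
    have eq: "subset_avg (\<lambda>B. run_upto q t (intersects ({} \<union> B))) ?U i = ?f i t"
      if "i = k \<or> i = k + d" for i
      using queries t that
      by (intro subset_avg_cong run_upto_eq_run[THEN trans])
        (auto simp: eggt_queries_at_most_def sized_subsets_def)
    have "?f (k + d) t \<le> sqrt (M ^ q * ?f k t) + 2 * real (k + d) / real n"
      using subset_avg_run_upto_bound[of "k - q" d M ?U q k t "{}"] M \<open>q < k\<close> eq by simp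
    also have "2 * real (k + d) / real n \<le> 1 / 100"
      using n n0 by (simp add: divide_le_eq)
    \<comment> \<open>The tangent of the square root at \<open>4 / 9\<close> gives a linear bound,
      which the expectation over trees respects.\<close>
    also have "sqrt (M ^ q * ?f k t) \<le> 3 / 4 * (M ^ q * ?f k t) + 1 / 3"
    proof -
      define s where "s = sqrt (M ^ q * ?f k t)"
      have "s\<^sup>2 = M ^ q * ?f k t"
        using Mq by (simp add: s_def subset_avg_nonneg)
      moreover have "s \<le> 3 / 4 * s\<^sup>2 + 1 / 3"
        using zero_le_power2[of "3 * s - 2"] by (simp add: power2_eq_square algebra_simps)
      ultimately show ?thesis
        by (simp add: s_def)
    qed
    finally show ?thesis by simp
  qed
  then have "measure_pmf.expectation p (?f (k + d))
      \<le> measure_pmf.expectation p (\<lambda>t. 3 / 4 * (M ^ q * ?f k t) + 1 / 3 + 1 / 100)"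
    by (intro integral_mono_AE expectation_subset_avg Bochner_Integration.integrable_add
        integrable_mult_right) (auto simp: AE_measure_pmf_iff)
  also have "\<dots> = 3 / 4 * (M ^ q * measure_pmf.expectation p (?f k)) + 1 / 3 + 1 / 100"
  proof -
    have "measure_pmf.expectation p (\<lambda>t. a * g t + b + c) = a * measure_pmf.expectation p g + b + c"
      if "integrable p g" for a b c :: real and g
      using that by simp
    from this[OF expectation_subset_avg(1), of "3 / 4 * M ^ q" _ _ _ "1 / 3" "1 / 100"]
    show ?thesis
      by (simp only: mult.assoc)
  qed
  finally have le: "measure_pmf.expectation p (?f (k + d))
      \<le> 3 / 4 * (M ^ q * measure_pmf.expectation p (?f k)) + 1 / 3 + 1 / 100" .
  have "measure_pmf.expectation p (?f k) \<le> 1 / 3"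
  proof -
    have "(\<Sum>B | B \<subseteq> ?U \<and> card B = k. measure_pmf.prob p {t. run t (intersects B)})
        \<le> (\<Sum>B | B \<subseteq> ?U \<and> card B = k. 1 / 3)"
    proof (rule sum_mono)
      fix B assume "B \<in> {B. B \<subseteq> ?U \<and> card B = k}"
      then have "2 / 3 \<le> measure_pmf.prob p {t. \<not> run t (intersects B)}"
        using solves by (simp add: solves_eggt_def sized_subsets_def)
      moreover have "measure_pmf.prob p {t. \<not> run t (intersects B)}
          = 1 - measure_pmf.prob p {t. run t (intersects B)}"
        using measure_pmf.prob_compl[of "{t. run t (intersects B)}" p]
        by (simp add: Compl_eq_Diff_UNIV[symmetric] Collect_neg_eq)
      ultimately show "measure_pmf.prob p {t. run t (intersects B)} \<le> 1 / 3"
        by linarith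
    qed
    then show ?thesis
      using n0 by (simp add: expectation_subset_avg n_subsets divide_le_eq)
  qed
  then have "M ^ q * measure_pmf.expectation p (?f k) \<le> M ^ q * (1 / 3)"
    using Mq by (rule mult_left_mono)
  moreover have "2 / 3 \<le> measure_pmf.expectation p (?f (k + d))"
  proof -
    have "(\<Sum>B | B \<subseteq> ?U \<and> card B = k + d. 2 / 3)
        \<le> (\<Sum>B | B \<subseteq> ?U \<and> card B = k + d. measure_pmf.prob p {t. run t (intersects B)})"
      using solves by (intro sum_mono) (simp add: solves_eggt_def sized_subsets_def)
    then show ?thesis
      using n0 by (simp add: expectation_subset_avg n_subsets le_divide_eq)
  qed
  ultimately show ?thesis
    using le by linarith
qed

section \<open>The lower bound on the query complexity\<close>

lemma eggt_query_complexity_ge: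
  assumes k: "k \<ge> 1" and d: "d \<ge> 1" and n: "200 * (k + d) \<le> n"
  shows "min (real k) (1 + (real k / real d)\<^sup>2) / 80 \<le> real (eggt_query_complexity n k d)"
proof -
  define q where "q = eggt_query_complexity n k d"
  obtain p where p: "solves_eggt n k d p" "eggt_queries_at_most n k d p q"
    using eggt_query_complexity_attained[OF d] unfolding q_def by blast
  show ?thesis
  proof (cases "2 * q \<ge> k")
    case True
    then have "real k \<le> 2 * real q" by linarith
    then have "min (real k) (1 + (real k / real d)\<^sup>2) \<le> 80 * real q"
      by linarith
    then show ?thesis
      by (simp add: q_def)
  next
    case False
    \<comment> \<open>\<open>1 + x\<close> serves as \<open>M\<close>: from
      \<open>k - q > k / 2\<close> follows \<open>d / (k - q) \<le> 2 * d / k\<close>, and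
      \<open>2 * 2\<^sup>2 = 8\<close>.\<close>
    define x where "x = 8 * (real d / real k)\<^sup>2"
    have "real d / real (k - q) \<le> 2 * (real d / real k)"
    proof -
      have "real k \<le> 2 * real (k - q)" "0 < real (k - q)"
        using False by linarith+
      then have "real k * real d \<le> 2 * real (k - q) * real d"
        by (intro mult_right_mono) auto
      then show ?thesis
        using k \<open>0 < real (k - q)\<close> by (simp add: field_simps del: of_nat_diff)
    qed
    then have "(real d / real (k - q))\<^sup>2 \<le> (2 * (real d / real k))\<^sup>2"
      by (intro power_mono) auto
    then have "1 + 2 * (real d / real (k - q))\<^sup>2 \<le> 1 + x"
      by (simp add: x_def power_mult_distrib power_divide)
    then have Mq: "5 / 4 \<le> (1 + x) ^ q"
      using solves_eggt_moment_bound[OF p _ n] False by simp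
    \<comment> \<open>That \<open>q\<close> is positive pays for the summand 1 in the final
      bound.\<close>
    then have q1: "q \<noteq> 0"
      by (intro notI) simp
    \<comment> \<open>Otherwise
      \<open>(1 + x) ^ q \<le> exp (1 / 5) \<le> 31 / 25 < 5 / 4\<close>.\<close>
    have "1 / 5 \<le> real q * x"
    proof (rule ccontr)
      assume "\<not> ?thesis"
      then have "exp (real q * x) \<le> exp (1 / 5)" by simp
      moreover have "exp (1 / 5 :: real) \<le> 31 / 25"
        using exp_bound[of "1 / 5"] by (simp add: power2_eq_square)
      moreover have "(1 + x) ^ q \<le> exp x ^ q"
        by (intro power_mono exp_ge_add_one_self) (simp add: x_def)
      moreover have "exp x ^ q = exp (real q * x)"
        by (simp add: exp_of_nat_mult)
      ultimately show False
        using Mq by linarith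
    qed
    then have "(real k / real d)\<^sup>2 \<le> 40 * real q"
      using k d by (simp add: x_def field_simps)
    moreover have "1 \<le> real q"
      using q1 by simp
    ultimately have "min (real k) (1 + (real k / real d)\<^sup>2) \<le> 80 * real q"
      by linarith
    then show ?thesis
      by (simp add: q_def)
  qed
qed

theorem theorem3p5:
  "\<exists>(c::real) (C::nat). c > 0 \<and>
     (\<forall>k d :: nat. k \<ge> 1 \<longrightarrow> d \<ge> 1 \<longrightarrow>
        (\<exists>n \<ge> k + d. real (eggt_query_complexity n k d) \<ge>
           c * min (real k) (1 + (real k / real d)\<^sup>2) / (1 + ln (real k)) ^ C))"
\<comment> \<open>The exponent 0 is possible because the argument loses no logarithmic
  factor.\<close>
proof (rule exI[of _ "1 / 80"], rule exI[of _ 0], intro conjI allI impI)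
  fix k d :: nat
  assume "k \<ge> 1" "d \<ge> 1"
  then show "\<exists>n \<ge> k + d. real (eggt_query_complexity n k d) \<ge>
      1 / 80 * min (real k) (1 + (real k / real d)\<^sup>2) / (1 + ln (real k)) ^ 0"
    using eggt_query_complexity_ge[of k d "200 * (k + d)"]
    by (intro exI[of _ "200 * (k + d)"]) simp
qed simp

end
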